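(* Let $B=(\mathbf b_1,\mathbf b_2,\mathbf b_3)$ be a basis of a full-rank lattice $\Lambda\subset\mathbb R^3$, let $K\subset\mathbb R^3$ be a convex body, and for $\sigma\in S_3$ let $$X_\sigma(K;B)=K\cap(K-\mathbf b_{\sigma(1)})\cap(K-\mathbf b_{\sigma(1)}-\mathbf b_{\sigma(2)})\cap(K-\mathbf b_1-\mathbf b_2-\mathbf b_3).$$ 1. For each $\sigma\in S_3$, a translate of $\Delta_\sigma(B)$ is contained in $K$ if and only if $X_\sigma(K;B)\ne\varnothing$. 2. If $X_\sigma(K;B)\neq\varnothing$ for all $\sigma\in S_3$, then $K+\Lambda=\mathbb R^3$. 3. If $X_\sigma(K;B)\neq\varnothing$ for all $\sigma\in S_3$ and $K$ is a minimal covering body for $\Lambda$, then for any choices $\mathbf t_\sigma\in X_\sigma(K;B)$ ($\sigma\in S_3$), $$K=\operatorname{conv}\bigcup_{\sigma\in S_3}\bigl(\mathbf t_\sigma+\Delta_\sigma(B)\bigr).$$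
   Context: A convex body in $\mathbb R^n$ is a compact convex set with nonempty interior. A convex body $K$ is a minimal covering body for a full-rank lattice $\Lambda$ if $K+\Lambda=\mathbb R^n$ and no proper convex subbody $K'\subsetneq K$ (i.e. no convex body properly contained in $K$) satisfies $K'+\Lambda=\mathbb R^n$. For a lattice basis $B=(\mathbf b_1,\mathbf b_2,\mathbf b_3)$ and $\sigma\in S_3$, $$\Delta_\sigma(B)=\operatorname{conv}\{\mathbf 0,\ \mathbf b_{\sigma(1)},\ \mathbf b_{\sigma(1)}+\mathbf b_{\sigma(2)},\ \mathbf b_1+\mathbf b_2+\mathbf b_3\}.$$ *)

theory Defs
  imports "HOL-Analysis.Analysis" "HOL-Library.Set_Algebras"
begin

text \<open>
  Vectors of \<open>\<real>\<^sup>3\<close> are elements of \<^typ>\<open>real ^ 3\<close>, and a triple \<open>(b\<^sub>1, b\<^sub>2, b\<^sub>3)\<close> of them is a function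
  \<open>B\<close> on the index type \<^typ>\<open>3\<close>, with \<open>b\<^sub>i = B i\<close>.  The elements of \<^typ>\<open>3\<close> are \<open>1\<close>, \<open>2\<close> and \<open>3\<close>
  (where \<open>3 = 0\<close>), so \<open>S\<^sub>3\<close> is the set of all \<open>\<sigma>\<close> with \<open>\<sigma> permutes (UNIV :: 3 set)\<close>.
  For sets, \<open>K + \<Lambda>\<close> is the Minkowski sum.
\<close>

definition convex_body :: "'a::euclidean_space set \<Rightarrow> bool" where
  "convex_body K \<longleftrightarrow> compact K \<and> convex K \<and> interior K \<noteq> {}"

text \<open>
  A full-rank lattice in \<open>\<real>\<^sup>n\<close> is the integer span of \<open>n\<close> linearly independent vectors.  Since the
  index type \<^typ>\<open>'n\<close> of the family is also that of the coordinates, \<open>lattice_basis B \<Lambda>\<close>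
  includes that \<open>\<Lambda>\<close> is a full-rank lattice.  Injectivity makes the family, and not only its
  range, linearly independent.
\<close>

definition lattice_basis :: "('n::finite \<Rightarrow> real ^ 'n) \<Rightarrow> (real ^ 'n) set \<Rightarrow> bool" where
  "lattice_basis B \<Lambda> \<longleftrightarrow>
     inj B \<and> independent (range B) \<and>
     \<Lambda> = range (\<lambda>c :: 'n \<Rightarrow> int. \<Sum>i\<in>UNIV. of_int (c i) *\<^sub>R B i)"

definition minimal_covering_body :: "(real ^ 'n) set \<Rightarrow> (real ^ 'n) set \<Rightarrow> bool" where
  "minimal_covering_body \<Lambda> K \<longleftrightarrow>
     convex_body K \<and> K + \<Lambda> = UNIV \<and>
     (\<forall>K'. convex_body K' \<and> K' \<subset> K \<longrightarrow> K' + \<Lambda> \<noteq> UNIV)"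

definition Delta :: "(3 \<Rightarrow> 3) \<Rightarrow> (3 \<Rightarrow> real ^ 3) \<Rightarrow> (real ^ 3) set" where
  "Delta \<sigma> B = convex hull {0, B (\<sigma> 1), B (\<sigma> 1) + B (\<sigma> 2), B 1 + B 2 + B 3}"

definition X_set :: "(3 \<Rightarrow> 3) \<Rightarrow> (real ^ 3) set \<Rightarrow> (3 \<Rightarrow> real ^ 3) \<Rightarrow> (real ^ 3) set" where
  "X_set \<sigma> K B =
     K \<inter> (\<lambda>x. x - B (\<sigma> 1)) ` K
       \<inter> (\<lambda>x. x - B (\<sigma> 1) - B (\<sigma> 2)) ` K
       \<inter> (\<lambda>x. x - B 1 - B 2 - B 3) ` K"

end

theory Submission
  imports Defs
begin

text \<open>
  By convexity, \<open>t + \<Delta>\<^sub>\<sigma>(B) \<subseteq> K\<close> only asks that \<open>K\<close> contain the translates by \<open>t\<close> of the four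
  vertices of \<open>\<Delta>\<^sub>\<sigma>(B)\<close>, which is \<open>t \<in> X\<^sub>\<sigma>(K;B)\<close>; this is the first claim.

  The second claim is the substantial one.  The translates \<open>\<nu> - \<Delta>\<^sub>\<sigma>(B)\<close> with \<open>\<nu> \<in> \<Lambda>\<close> form a
  triangulation of space (Kuhn's), but moving the six classes of simplices by six unrelated vectors
  \<open>t\<^sub>\<sigma>\<close> tears it apart, so volume or tiling arguments give nothing.  Instead, attach to each simplex
  \<open>\<nu> - \<Delta>\<^sub>\<sigma>(B)\<close> the point \<open>\<nu> + t\<^sub>\<sigma>\<close>.  If \<open>l \<in> \<Lambda>\<close> is a vertex of that simplex, then \<open>\<nu> = l + p\<close>
  with a vertex \<open>p\<close> of \<open>\<Delta>\<^sub>\<sigma>(B)\<close>, hence \<open>\<nu> + t\<^sub>\<sigma> = l + (t\<^sub>\<sigma> + p) \<in> l + K\<close>.  So all simplices that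
  share the vertex \<open>l\<close> send their points to one and the same convex set \<open>l + K\<close>.  Let \<open>\<phi>(x)\<close> be a
  continuous weighted mean of the points of the simplices that come close to \<open>x\<close>.  These simplices
  have a common vertex (\<open>nearby_simplices_common_vertex\<close>), whence \<open>\<phi>(x) \<in> K + \<Lambda>\<close>.  As \<open>\<phi>\<close> moves
  points by a bounded amount, Brouwer's theorem makes it surjective
  (\<open>bounded_displacement_attains\<close>), and \<open>K + \<Lambda>\<close> is the whole space.

  For the third claim, the convex hull of the six translated simplices lies in \<open>K\<close> and satisfies the
  hypothesis of the second claim, so it covers as well.  It is a convex body, and minimality
  of \<open>K\<close> forces equality.
\<close>

section \<open>A covering criterion from Brouwer's theorem\<close>

text \<open>
  A solution of \<open>f x = y\<close> is a fixed point of \<open>x \<mapsto> x - f x + y\<close>, which maps the ball of radius \<open>M\<close>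
  about \<open>y\<close> into itself.
\<close>

lemma bounded_displacement_attains:
  fixes f :: "'a::euclidean_space \<Rightarrow> 'a"
  assumes cont: "continuous_on (cball y M) f"
    and disp: "\<And>x. x \<in> cball y M \<Longrightarrow> norm (f x - x) \<le> M" and "0 \<le> M"
  shows "\<exists>x\<in>cball y M. f x = y"
proof -
  let ?g = "\<lambda>x. x - f x + y"
  have "continuous_on (cball y M) ?g"
    by (intro continuous_intros cont)
  moreover have "?g \<in> cball y M \<rightarrow> cball y M"
    using disp by (auto simp: dist_norm)
  ultimately obtain x where "x \<in> cball y M" and "?g x = x"
    using brouwer[of "cball y M" ?g] \<open>0 \<le> M\<close> by auto
  then show ?thesis
    by (auto simp: algebra_simps)
qed

text \<open>
  The map to which \<open>bounded_displacement_attains\<close> applies is the mean of the points \<open>c i\<close> with the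
  normalised weights.  Convexity is used twice: for the ball of radius \<open>M\<close>, to bound the displacement
  of the mean, and for \<open>K\<close>, to keep the mean in the set \<open>l + K\<close> that contains all points of positive
  weight.  Only the ball about the target \<open>y\<close> matters, so a finite family suffices.
\<close>

lemma weighted_points_cover:
  fixes K \<Lambda> :: "'a::euclidean_space set" and w :: "'i \<Rightarrow> 'a \<Rightarrow> real" and c :: "'i \<Rightarrow> 'a"
  assumes "convex K" and "finite I" and "0 \<le> M"
    and cont: "\<And>i. i \<in> I \<Longrightarrow> continuous_on (cball y M) (w i)"
    and nonneg: "\<And>i x. i \<in> I \<Longrightarrow> 0 \<le> w i x"
    and pos: "\<And>x. x \<in> cball y M \<Longrightarrow> \<exists>i\<in>I. 0 < w i x"
    and near: "\<And>i x. i \<in> I \<Longrightarrow> 0 < w i x \<Longrightarrow> norm (c i - x) \<le> M"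
    and same: "\<And>x. x \<in> cball y M \<Longrightarrow> \<exists>l\<in>\<Lambda>. \<forall>i\<in>I. 0 < w i x \<longrightarrow> c i - l \<in> K"
  shows "\<exists>l\<in>\<Lambda>. y - l \<in> K"
proof -
  define W where "W x = (\<Sum>i\<in>I. w i x)" for x
  define u where "u i x = w i x / W x" for i x
  have W_pos: "0 < W x" if "x \<in> cball y M" for x
  proof -
    obtain i where "i \<in> I" "0 < w i x"
      using pos \<open>x \<in> cball y M\<close> by blast
    then show ?thesis
      unfolding W_def using nonneg \<open>finite I\<close> by (intro sum_pos2) auto
  qed
  have u_sum: "(\<Sum>i\<in>I. u i x) = 1" if "x \<in> cball y M" for x
    using W_pos[OF that] by (simp add: u_def W_def flip: sum_divide_distrib)
  have u_nonneg: "0 \<le> u i x" if "x \<in> cball y M" "i \<in> I" for i x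
    using W_pos[OF that(1)] nonneg[OF that(2)] by (simp add: u_def)
  \<comment> \<open>Points of weight zero need not satisfy the membership condition, so they are removed first.\<close>
  have mean_in: "(\<Sum>i\<in>I. u i x *\<^sub>R c i) - l \<in> C"
    if x: "x \<in> cball y M" and "convex C" and C: "\<And>i. i \<in> I \<Longrightarrow> 0 < w i x \<Longrightarrow> c i - l \<in> C"
    for x l C
  proof -
    let ?J = "{i\<in>I. 0 < w i x}"
    have u0: "u i x = 0" if "i \<in> I - ?J" for i
      using that nonneg[of i x] by (auto simp: u_def)
    have "(\<Sum>i\<in>?J. u i x *\<^sub>R (c i - l)) \<in> C"
    proof (rule convex_sum[OF _ \<open>convex C\<close>])
      show "(\<Sum>i\<in>?J. u i x) = 1"
        using sum.mono_neutral_left[of I ?J "\<lambda>i. u i x"] u0 u_sum[OF x] \<open>finite I\<close> by auto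
    qed (use \<open>finite I\<close> u_nonneg[OF x] C in auto)
    also have "(\<Sum>i\<in>?J. u i x *\<^sub>R (c i - l)) = (\<Sum>i\<in>I. u i x *\<^sub>R (c i - l))"
      using u0 \<open>finite I\<close> by (intro sum.mono_neutral_left) auto
    also have "\<dots> = (\<Sum>i\<in>I. u i x *\<^sub>R c i) - (\<Sum>i\<in>I. u i x) *\<^sub>R l"
      by (simp add: algebra_simps sum_subtractf scaleR_left.sum)
    finally show ?thesis
      by (simp add: u_sum[OF x])
  qed
  have "\<exists>x\<in>cball y M. (\<Sum>i\<in>I. u i x *\<^sub>R c i) = y"
  proof (rule bounded_displacement_attains[OF _ _ \<open>0 \<le> M\<close>])
    have "W x \<noteq> 0" if "x \<in> cball y M" for x
      using W_pos[OF that] by simp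
    then show "continuous_on (cball y M) (\<lambda>x. \<Sum>i\<in>I. u i x *\<^sub>R c i)"
      unfolding u_def W_def by (intro continuous_intros cont) auto
  next
    fix x assume x: "x \<in> cball y M"
    show "norm ((\<Sum>i\<in>I. u i x *\<^sub>R c i) - x) \<le> M"
      using mean_in[OF x convex_cball[of 0 M], of x] near by auto
  qed
  then obtain x where x: "x \<in> cball y M" and y: "(\<Sum>i\<in>I. u i x *\<^sub>R c i) = y"
    by blast
  obtain l where "l \<in> \<Lambda>" and "\<And>i. i \<in> I \<Longrightarrow> 0 < w i x \<Longrightarrow> c i - l \<in> K"
    using same[OF x] by blast
  then show ?thesis
    using mean_in[OF x \<open>convex K\<close>, of l] y by auto
qed

section \<open>The Kuhn triangulation\<close>

text \<open>
  Modulo \<open>1\<close>, the \<open>n + 1\<close> open arcs of radius \<open>\<delta> = 1 / (2 (n + 1))\<close> about the odd multiples of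
  \<open>\<delta>\<close> are disjoint, so one of them contains none of the \<open>n\<close> given residues.  All these centres are
  also at distance at least \<open>\<delta>\<close> from \<open>0\<close>, which gives the bounds on \<open>c\<close>.
\<close>

lemma residue_gap:
  fixes A :: "real set"
  assumes "finite A" and \<delta>: "\<delta> = 1 / (2 * (real (card A) + 1))"
  obtains c where "\<delta> \<le> c" and "c \<le> 1 - \<delta>"
    and "\<And>a k. a \<in> A \<Longrightarrow> \<delta> \<le> \<bar>a - c - of_int k\<bar>"
proof -
  define n where "n = card A"
  define c where "c j = (2 * real j + 1) * \<delta>" for j :: nat
  have \<delta>n: "2 * (real n + 1) * \<delta> = 1" and "0 < \<delta>"
    by (auto simp: \<delta> n_def)
  have "\<exists>j\<le>n. \<forall>a\<in>A. \<forall>k. \<delta> \<le> \<bar>a - c j - of_int k\<bar>"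
  proof (rule ccontr)
    assume "\<not> ?thesis"
    then have "\<forall>j\<in>{..n}. \<exists>a. a \<in> A \<and> (\<exists>k. \<bar>a - c j - of_int k\<bar> < \<delta>)"
      by (meson atMost_iff not_le)
    from bchoice[OF this] obtain g where g: "\<forall>j\<in>{..n}. g j \<in> A \<and> (\<exists>k. \<bar>g j - c j - of_int k\<bar> < \<delta>)"
      by blast
    \<comment> \<open>No point lies in two arcs: distinct centres differ by at least \<open>2\<delta>\<close> modulo \<open>1\<close>.\<close>
    have "inj_on g {..n}"
    proof (rule inj_onI)
      fix i j assume ij: "i \<in> {..n}" "j \<in> {..n}" and eq: "g i = g j"
      obtain k l where "\<bar>g i - c i - of_int k\<bar> < \<delta>" and "\<bar>g j - c j - of_int l\<bar> < \<delta>"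
        using g ij by blast
      then have "\<bar>c i - c j - of_int (l - k)\<bar> < 2 * \<delta>"
        using eq by simp
      moreover have "c i - c j - of_int (l - k)
          = 2 * \<delta> * of_int (int i - int j - (l - k) * (int n + 1))"
      proof -
        have "real_of_int (l - k) = of_int (l - k) * (2 * (real n + 1) * \<delta>)"
          by (simp only: \<delta>n mult_1_right)
        then show ?thesis
          by (simp add: c_def algebra_simps)
      qed
      ultimately have "2 * \<delta> * \<bar>of_int (int i - int j - (l - k) * (int n + 1))\<bar> < 2 * \<delta> * 1"
        using \<open>0 < \<delta>\<close> by (simp add: abs_mult)
      then have "\<bar>real_of_int (int i - int j - (l - k) * (int n + 1))\<bar> < 1"
        using \<open>0 < \<delta>\<close> by (subst (asm) mult_less_cancel_left_pos) auto
      then have "int i - int j = (l - k) * (int n + 1)"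
        by linarith
      then have "(int n + 1) dvd (int i - int j)"
        by simp
      then have "int i - int j = 0"
        using ij zdvd_not_zless[of "\<bar>int i - int j\<bar>" "int n + 1"] by fastforce
      then show "i = j" by simp
    qed
    then have "card {..n} \<le> card A"
      using g \<open>finite A\<close> by (intro card_inj_on_le[of g]) auto
    then show False by (simp add: n_def)
  qed
  then obtain j where j: "j \<le> n" and jA: "\<forall>a\<in>A. \<forall>k. \<delta> \<le> \<bar>a - c j - of_int k\<bar>"
    by blast
  have "(2 * real j + 2) * \<delta> \<le> 2 * (real n + 1) * \<delta>"
    using j \<open>0 < \<delta>\<close> by (intro mult_right_mono) auto
  then have "c j \<le> 1 - \<delta>"
    using \<delta>n by (simp add: c_def algebra_simps)
  moreover have "\<delta> \<le> c j"
    using \<open>0 < \<delta>\<close> by (simp add: c_def algebra_simps)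
  ultimately show ?thesis
    using jA that by blast
qed

definition corners :: "(3 \<Rightarrow> 3) \<Rightarrow> (3 \<Rightarrow> real ^ 3) \<Rightarrow> (real ^ 3) set" where
  "corners \<sigma> B = {0, B (\<sigma> 1), B (\<sigma> 1) + B (\<sigma> 2), B 1 + B 2 + B 3}"

abbreviation unit_vec :: "3 \<Rightarrow> real ^ 3" where
  "unit_vec i \<equiv> axis i 1"

definition int_vec :: "('n::finite \<Rightarrow> int) \<Rightarrow> real ^ 'n" where
  "int_vec f = (\<chi> i. of_int (f i))"

text \<open>
  For a permutation \<open>\<sigma>\<close>, the smallest barycentric coordinate of \<open>y\<close> with respect to the simplex spanned by
  \<open>corners \<sigma> unit_vec\<close>.  It is nonnegative exactly on that simplex, which is
  \<open>1 \<ge> y $ \<sigma> 1 \<ge> y $ \<sigma> 2 \<ge> y $ \<sigma> 3 \<ge> 0\<close>, and slightly negative near it.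
\<close>

definition depth :: "(3 \<Rightarrow> 3) \<Rightarrow> real ^ 3 \<Rightarrow> real" where
  "depth \<sigma> y = min (min (1 - y $ \<sigma> 1) (y $ \<sigma> 1 - y $ \<sigma> 2)) (min (y $ \<sigma> 2 - y $ \<sigma> 3) (y $ \<sigma> 3))"

lemma all_3_perm:
  assumes "\<sigma> permutes (UNIV :: 3 set)"
  shows "(\<forall>i. P i) \<longleftrightarrow> P (\<sigma> 1) \<and> P (\<sigma> 2) \<and> P (\<sigma> 3)"
proof -
  have "(\<forall>i. P i) \<longleftrightarrow> (\<forall>j. P (\<sigma> j))"
    using permutes_surj[OF assms] by (metis surj_def)
  then show ?thesis by (simp add: forall_3)
qed

lemma sorting_permutation:
  fixes f :: "3 \<Rightarrow> real"
  obtains \<sigma> where "\<sigma> permutes UNIV" and "f (\<sigma> 2) \<le> f (\<sigma> 1)" and "f (\<sigma> 3) \<le> f (\<sigma> 2)"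
proof -
  note result = that
  have mk: thesis if "distinct [i, j, k]" and "f j \<le> f i" "f k \<le> f j" for i j k :: 3
  proof (rule result)
    let ?s = "\<lambda>x::3. if x = 1 then i else if x = 2 then j else k"
    have "inj ?s"
      using \<open>distinct [i, j, k]\<close> by (auto simp: inj_def forall_3)
    then have "bij ?s"
      by (simp only: bij_def finite_UNIV_inj_surj finite simp_thms)
    then show "?s permutes UNIV"
      by (rule bij_imp_permutes) blast
  qed (use that in auto)
  have "distinct [1, 2, 3 :: 3]" "distinct [1, 3, 2 :: 3]" "distinct [2, 1, 3 :: 3]"
    "distinct [2, 3, 1 :: 3]" "distinct [3, 1, 2 :: 3]" "distinct [3, 2, 1 :: 3]"
    by simp_all
  from this[THEN mk] show thesis
    using linear[of "f 1" "f 2"] linear[of "f 1" "f 3"] linear[of "f 2" "f 3"] by blast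
qed

text \<open>
  Rounding the coordinates up leaves a remainder in the unit cube, and the order of its coordinates
  tells the simplex.
\<close>

lemma kuhn_simplex_containing:
  fixes x :: "real ^ 3"
  obtains f \<sigma> where "\<sigma> permutes UNIV" and "0 \<le> depth \<sigma> (int_vec f - x)"
    and "\<And>i. \<bar>of_int (f i) - x $ i\<bar> \<le> 1"
proof -
  define f where "f i = \<lceil>x $ i\<rceil>" for i
  define y where "y = int_vec f - x"
  have y: "0 \<le> y $ i" "y $ i \<le> 1" for i
    unfolding y_def int_vec_def f_def by simp_all linarith+
  obtain \<sigma> where "\<sigma> permutes UNIV" and "y $ \<sigma> 2 \<le> y $ \<sigma> 1" and "y $ \<sigma> 3 \<le> y $ \<sigma> 2"
    using sorting_permutation[of "\<lambda>i. y $ i"] by blast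
  then have "0 \<le> depth \<sigma> y"
    by (simp add: depth_def y)
  moreover have "\<bar>of_int (f i) - x $ i\<bar> \<le> 1" for i
    using y[of i] by (simp add: y_def int_vec_def)
  ultimately show ?thesis
    using that \<open>\<sigma> permutes UNIV\<close> y_def by blast
qed

lemma depth_coordinate_bounds:
  assumes "\<sigma> permutes (UNIV :: 3 set)" and "- (1/32) < depth \<sigma> y"
  shows "- (1/8) < y $ i" and "y $ i < 9/8"
proof -
  have d: "- (1/32) < 1 - y $ \<sigma> 1" "- (1/32) < y $ \<sigma> 1 - y $ \<sigma> 2"
    "- (1/32) < y $ \<sigma> 2 - y $ \<sigma> 3" "- (1/32) < y $ \<sigma> 3"
    using assms(2) by (simp_all add: depth_def)
  then have mid: "- (1/16) < y $ \<sigma> 2" "y $ \<sigma> 2 < 17/16"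
    by linarith+
  have "- (1/8) < y $ \<sigma> 1" "y $ \<sigma> 3 < 9/8"
    using d(2,3) mid by linarith+
  moreover have "- (1/8) < y $ \<sigma> 2" "- (1/8) < y $ \<sigma> 3" "y $ \<sigma> 1 < 9/8" "y $ \<sigma> 2 < 9/8"
    using d(1,4) mid by linarith+
  ultimately have "\<forall>i. - (1/8) < y $ i \<and> y $ i < 9/8"
    unfolding all_3_perm[OF assms(1)] by blast
  then show "- (1/8) < y $ i" and "y $ i < 9/8" by auto
qed

text \<open>
  The open stars of the vertices cover space with a positive Lebesgue number.  A vertex whose star
  contains a neighbourhood of \<open>x\<close> comes from a cut \<open>c\<close> that is at distance at least \<open>1/8\<close>, modulo
  \<open>1\<close>, from \<open>0\<close> and from the three coordinates of \<open>-x\<close>: round these coordinates relative to \<open>c\<close>.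
  For a simplex \<open>f - \<Delta>\<^sub>\<sigma>\<close> near \<open>x\<close>, the coordinates of \<open>f - x\<close> decrease along \<open>\<sigma>\<close> up to an error
  of \<open>1/32\<close>; since none is that close to \<open>c\<close>, those above \<open>c\<close> form an initial segment of
  \<open>\<sigma> 1, \<sigma> 2, \<sigma> 3\<close>.  The sum of the corresponding unit vectors is a vertex of \<open>\<Delta>\<^sub>\<sigma>\<close>, and it is the
  difference between \<open>f\<close> and the rounded vector.
\<close>

lemma nearby_simplices_common_vertex:
  fixes x :: "real ^ 3"
  shows "\<exists>l. \<forall>\<sigma> f. \<sigma> permutes UNIV \<longrightarrow> - (1/32) < depth \<sigma> (int_vec f - x) \<longrightarrow>
           int_vec f - int_vec l \<in> corners \<sigma> unit_vec"
proof -
  let ?A = "range (\<lambda>i. - x $ i)"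
  have "card ?A \<le> 3"
    using card_image_le[of "UNIV :: 3 set" "\<lambda>i. - x $ i"] by simp
  then have \<delta>: "1/8 \<le> 1 / (2 * (real (card ?A) + 1))"
    by (simp add: field_simps)
  obtain c where c': "1 / (2 * (real (card ?A) + 1)) \<le> c" "c \<le> 1 - 1 / (2 * (real (card ?A) + 1))"
    and gap': "\<And>a k. a \<in> ?A \<Longrightarrow> 1 / (2 * (real (card ?A) + 1)) \<le> \<bar>a - c - of_int k\<bar>"
    using residue_gap[OF _ refl, of ?A] by auto
  have c: "1/8 \<le> c" "c \<le> 7/8"
    using c' \<delta> by linarith+
  have gap: "1/8 \<le> \<bar>- x $ i - c - of_int k\<bar>" for i k
    by (rule order_trans[OF \<delta> gap']) simp
  \<comment> \<open>Chosen so that \<open>f i - l i = \<lfloor>f i - x $ i - c\<rfloor> + 1\<close>, while \<open>l\<close> depends on \<open>x\<close> only.\<close>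
  define l where "l i = - \<lfloor>- x $ i - c\<rfloor> - 1" for i
  have "int_vec f - int_vec l \<in> corners \<sigma> unit_vec"
    if \<sigma>: "\<sigma> permutes UNIV" and d: "- (1/32) < depth \<sigma> (int_vec f - x)" for \<sigma> f
  proof -
    define y where "y = int_vec f - x"
    define p where "p = int_vec f - int_vec l"
    have p: "p $ i = (if c \<le> y $ i then 1 else 0)" for i
    proof -
      have "p $ i = of_int (\<lfloor>y $ i - c\<rfloor> + 1)"
        using floor_add_int[of "- x $ i - c" "f i"]
        by (simp add: p_def y_def l_def int_vec_def algebra_simps)
      moreover have "- (1/8) < y $ i" "y $ i < 9/8"
        using depth_coordinate_bounds[OF \<sigma> d] by (auto simp: y_def)
      then have "\<lfloor>y $ i - c\<rfloor> = (if c \<le> y $ i then 0 else -1)"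
        using c by (auto simp: floor_eq_iff)
      ultimately show ?thesis by simp
    qed
    have gap_y: "c + 1/8 \<le> y $ i" if "c \<le> y $ i" for i
      using gap[of i "- f i"] that by (simp add: y_def int_vec_def)
    have "y $ \<sigma> 2 - 1/32 < y $ \<sigma> 1" "y $ \<sigma> 3 - 1/32 < y $ \<sigma> 2"
      using d by (auto simp: depth_def y_def)
    then have mono: "c \<le> y $ \<sigma> 2 \<Longrightarrow> c \<le> y $ \<sigma> 1" "c \<le> y $ \<sigma> 3 \<Longrightarrow> c \<le> y $ \<sigma> 2"
      using gap_y[of "\<sigma> 2"] gap_y[of "\<sigma> 3"] by auto
    have [simp]: "\<sigma> i = \<sigma> j \<longleftrightarrow> i = j" for i j
      using permutes_inj[OF \<sigma>] by (auto simp: inj_def)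
    have all_one: "(unit_vec 1 + unit_vec 2 + unit_vec 3) $ i = 1" for i
      using exhaust_3[of i] by (auto simp: axis_def)
    consider "\<not> c \<le> y $ \<sigma> 1" | "c \<le> y $ \<sigma> 1" "\<not> c \<le> y $ \<sigma> 2"
      | "c \<le> y $ \<sigma> 2" "\<not> c \<le> y $ \<sigma> 3" | "c \<le> y $ \<sigma> 3"
      by blast
    then have "p \<in> corners \<sigma> unit_vec"
    proof cases
      case 1
      then have "p = 0"
        using mono unfolding vec_eq_iff all_3_perm[OF \<sigma>] p by auto
      then show ?thesis by (simp add: corners_def)
    next
      case 2
      then have "p = unit_vec (\<sigma> 1)"
        using mono unfolding vec_eq_iff all_3_perm[OF \<sigma>] p by (auto simp: axis_def)
      then show ?thesis by (simp add: corners_def)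
    next
      case 3
      then have "p = unit_vec (\<sigma> 1) + unit_vec (\<sigma> 2)"
        using mono unfolding vec_eq_iff all_3_perm[OF \<sigma>] p by (auto simp: axis_def)
      then show ?thesis by (simp add: corners_def)
    next
      case 4
      then have "p = unit_vec 1 + unit_vec 2 + unit_vec 3"
        using mono unfolding vec_eq_iff all_one all_3_perm[OF \<sigma>] p by auto
      then show ?thesis by (simp add: corners_def)
    qed
    then show ?thesis by (simp add: p_def)
  qed
  then show ?thesis by blast
qed

section \<open>Convex sets containing the six simplices\<close>

text \<open>
  The second claim in coordinates.  The index \<open>(f, \<sigma>)\<close> stands for the simplex \<open>int_vec f - \<Delta>\<^sub>\<sigma>\<close>.
\<close>

lemma integer_translates_cover:
  fixes K :: "(real ^ 3) set"
  assumes "convex K"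
    and t: "\<And>\<sigma> p. \<sigma> permutes UNIV \<Longrightarrow> p \<in> corners \<sigma> unit_vec \<Longrightarrow> t \<sigma> + p \<in> K"
  shows "\<exists>f. y - int_vec f \<in> K"
proof -
  let ?S = "{\<sigma>. \<sigma> permutes (UNIV :: 3 set)}"
  have "finite ?S"
    by (simp add: finite_permutations)
  \<comment> \<open>A point near the simplex has distance at most \<open>6\<close> from \<open>int_vec f\<close>: each coordinate differs by at most \<open>2\<close>.\<close>
  define M where "M = (\<Sum>\<sigma>\<in>?S. norm (t \<sigma>)) + 6"
  have tM: "norm (t \<sigma>) + 6 \<le> M" if "\<sigma> permutes UNIV" for \<sigma>
    unfolding M_def using \<open>finite ?S\<close> that
    by (intro add_right_mono member_le_sum) auto
  have "0 \<le> M"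
    unfolding M_def by (intro add_nonneg_nonneg sum_nonneg) auto
  \<comment> \<open>Large enough that the finitely many simplices in \<open>I\<close> cover the ball of radius \<open>M\<close> about \<open>y\<close>.\<close>
  define N where "N = \<lceil>norm y + M + 1\<rceil>"
  define I where "I = (PiE UNIV (\<lambda>_. {- N..N}) :: (3 \<Rightarrow> int) set) \<times> ?S"
  define w where "w i x = max 0 (depth (snd i) (int_vec (fst i) - x) + 1/32)"
    for i :: "(3 \<Rightarrow> int) \<times> (3 \<Rightarrow> 3)" and x
  define c where "c i = t (snd i) + int_vec (fst i)" for i :: "(3 \<Rightarrow> int) \<times> (3 \<Rightarrow> 3)"
  have "\<exists>l\<in>range int_vec. y - l \<in> K"
  proof (rule weighted_points_cover[where I = I and w = w and c = c, OF \<open>convex K\<close> _ \<open>0 \<le> M\<close>])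
    show "finite I"
      unfolding I_def using \<open>finite ?S\<close> by (intro finite_cartesian_product finite_PiE) auto
    show "continuous_on (cball y M) (w i)" for i
      unfolding w_def depth_def by (intro continuous_intros)
    show "0 \<le> w i x" for i x
      by (simp add: w_def)
  next
    fix x assume x: "x \<in> cball y M"
    obtain f \<sigma> where \<sigma>: "\<sigma> permutes UNIV" and d: "0 \<le> depth \<sigma> (int_vec f - x)"
      and f: "\<And>i. \<bar>of_int (f i) - x $ i\<bar> \<le> 1"
      using kuhn_simplex_containing by blast
    have "norm x \<le> norm y + M"
      using x norm_triangle_ineq2[of x y] by (simp add: dist_norm norm_minus_commute)
    have "\<bar>f i\<bar> \<le> N" for i
    proof -
      have "real_of_int \<bar>f i\<bar> \<le> norm y + M + 1"
        using f[of i] component_le_norm_cart[of x i] \<open>norm x \<le> norm y + M\<close> by linarith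
      then show ?thesis
        unfolding N_def by linarith
    qed
    then have "(f, \<sigma>) \<in> I"
      using \<sigma> by (auto simp: I_def abs_le_iff minus_le_iff)
    moreover have "0 < w (f, \<sigma>) x"
      using d by (simp add: w_def)
    ultimately show "\<exists>i\<in>I. 0 < w i x" by blast
  next
    fix i x assume i: "i \<in> I" "0 < w i x"
    obtain f \<sigma> where [simp]: "i = (f, \<sigma>)" by (cases i)
    have \<sigma>: "\<sigma> permutes UNIV" and "- (1/32) < depth \<sigma> (int_vec f - x)"
      using i by (auto simp: I_def w_def)
    then have "\<bar>(int_vec f - x) $ k\<bar> \<le> 2" for k
      using depth_coordinate_bounds[of \<sigma> "int_vec f - x" k] by linarith
    then have "norm (int_vec f - x) \<le> (\<Sum>k\<in>(UNIV :: 3 set). 2)"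
      by (intro order_trans[OF norm_le_l1_cart] sum_mono)
    then show "norm (c i - x) \<le> M"
      using tM[OF \<sigma>] norm_triangle_ineq[of "t \<sigma>" "int_vec f - x"] by (simp add: c_def algebra_simps)
  next
    fix x
    obtain l where l: "\<And>\<sigma> f. \<sigma> permutes UNIV \<Longrightarrow> - (1/32) < depth \<sigma> (int_vec f - x) \<Longrightarrow>
           int_vec f - int_vec l \<in> corners \<sigma> unit_vec"
      using nearby_simplices_common_vertex by blast
    have "c i - int_vec l \<in> K" if "i \<in> I" "0 < w i x" for i
      using t[OF _ l, of "snd i" "fst i"] that
      by (auto simp: I_def w_def c_def algebra_simps)
    then show "\<exists>l\<in>range int_vec. \<forall>i\<in>I. 0 < w i x \<longrightarrow> c i - l \<in> K"
      by blast
  qed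
  then show ?thesis by blast
qed

lemma lattice_basis_coordinates:
  fixes B :: "'n::finite \<Rightarrow> real ^ 'n"
  assumes "lattice_basis B \<Lambda>"
  shows "bij (\<lambda>v :: real ^ 'n. \<Sum>i\<in>UNIV. v $ i *\<^sub>R B i)" (is "bij ?L")
    and "linear (\<lambda>v :: real ^ 'n. \<Sum>i\<in>UNIV. v $ i *\<^sub>R B i)"
    and "\<Lambda> = range (\<lambda>f. \<Sum>i\<in>UNIV. int_vec f $ i *\<^sub>R B i)"
    and "span (range B) = UNIV"
proof -
  have "inj B" and ind: "independent (range B)"
    and \<Lambda>: "\<Lambda> = range (\<lambda>c :: 'n \<Rightarrow> int. \<Sum>i\<in>UNIV. of_int (c i) *\<^sub>R B i)"
    using assms by (auto simp: lattice_basis_def)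
  show lin: "linear ?L"
    by (intro linearI) (simp_all add: algebra_simps sum.distrib scaleR_sum_right)
  have "card (range B) = DIM(real ^ 'n)"
    using card_image[OF \<open>inj B\<close>] by simp
  then show span: "span (range B) = UNIV"
    using ind dim_eq_full dim_eq_card_independent by metis
  have "B i \<in> range ?L" for i
  proof
    show "B i = ?L (axis i 1)"
      by (simp add: axis_def if_distrib[of "\<lambda>x. x *\<^sub>R _"] cong: if_cong)
  qed simp
  then have "span (range B) \<subseteq> range ?L"
    by (intro span_minimal linear_subspace_image[OF lin]) auto
  then have "surj ?L"
    using span by auto
  then show "bij ?L"
    using linear_surjective_imp_injective[OF lin] by (simp add: bij_def)
  show "\<Lambda> = range (\<lambda>f. \<Sum>i\<in>UNIV. int_vec f $ i *\<^sub>R B i)"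
    by (simp add: \<Lambda> int_vec_def)
qed

lemma corner_translates_cover:
  assumes B: "lattice_basis B \<Lambda>" and "convex K"
    and t: "\<And>\<sigma> p. \<sigma> permutes UNIV \<Longrightarrow> p \<in> corners \<sigma> B \<Longrightarrow> t \<sigma> + p \<in> K"
  shows "K + \<Lambda> = UNIV"
proof -
  define L where "L v = (\<Sum>i\<in>UNIV. v $ i *\<^sub>R B i)" for v :: "real ^ 3"
  have "bij L" and "linear L" and \<Lambda>: "\<Lambda> = range (\<lambda>f. L (int_vec f))"
    using lattice_basis_coordinates[OF B] unfolding L_def by auto
  interpret linear L by fact
  have L_unit: "L (unit_vec i) = B i" for i
    by (simp add: L_def axis_def if_distrib[of "\<lambda>x. x *\<^sub>R _"] cong: if_cong)
  have L_corner: "L p \<in> corners \<sigma> B" if "p \<in> corners \<sigma> unit_vec" for \<sigma> p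
    using that by (auto simp: corners_def add L_unit zero)
  have "y \<in> K + \<Lambda>" for y
  proof -
    have "inv L (t \<sigma>) + p \<in> L -` K" if "\<sigma> permutes UNIV" "p \<in> corners \<sigma> unit_vec" for \<sigma> p
      using t[OF that(1) L_corner[OF that(2)]] \<open>bij L\<close>
      by (simp add: add surj_f_inv_f bij_is_surj)
    then obtain f where "inv L y - int_vec f \<in> L -` K"
      using integer_translates_cover[of "L -` K" "\<lambda>\<sigma>. inv L (t \<sigma>)" "inv L y"]
        convex_linear_vimage[OF \<open>linear L\<close> \<open>convex K\<close>] by blast
    then have "y - L (int_vec f) \<in> K"
      using \<open>bij L\<close> by (simp add: diff surj_f_inv_f bij_is_surj)
    moreover have "L (int_vec f) \<in> \<Lambda>"
      by (simp add: \<Lambda>)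
    ultimately have "(y - L (int_vec f)) + L (int_vec f) \<in> K + \<Lambda>"
      by (rule set_plus_intro)
    then show ?thesis by simp
  qed
  then show ?thesis by auto
qed

lemma X_set_iff_corners: "t \<in> X_set \<sigma> K B \<longleftrightarrow> (\<forall>p\<in>corners \<sigma> B. t + p \<in> K)"
proof -
  have sub: "t \<in> (\<lambda>x. x - v) ` K \<longleftrightarrow> t + v \<in> K" for v
    by (force simp: image_iff)
  show ?thesis
    using sub[of "B (\<sigma> 1)"] sub[of "B (\<sigma> 1) + B (\<sigma> 2)"] sub[of "B 1 + B 2 + B 3"]
    by (simp add: X_set_def corners_def diff_diff_eq add.assoc)
qed

lemma Delta_translate_subset_iff:
  assumes "convex K"
  shows "(+) t ` Delta \<sigma> B \<subseteq> K \<longleftrightarrow> t \<in> X_set \<sigma> K B"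
proof -
  have "(+) t ` Delta \<sigma> B = convex hull ((+) t ` corners \<sigma> B)"
    by (simp only: Delta_def corners_def convex_hull_translation)
  also have "\<dots> \<subseteq> K \<longleftrightarrow> (+) t ` corners \<sigma> B \<subseteq> K"
    using hull_subset[of "(+) t ` corners \<sigma> B" convex] hull_minimal[of _ K convex] assms by blast
  finally show ?thesis
    by (auto simp: X_set_iff_corners)
qed

text \<open>
  Successive vertices of \<open>\<Delta>\<^sub>\<sigma>(B)\<close> differ by the three basis vectors, so a hyperplane containing a
  translate of all four would have a normal vector orthogonal to the whole space.
\<close>

lemma convex_interior_nonempty_of_corners:
  assumes B: "lattice_basis B \<Lambda>" and "convex K" and \<sigma>: "\<sigma> permutes UNIV"
    and t: "t \<in> X_set \<sigma> K B"
  shows "interior K \<noteq> {}"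
proof
  assume "interior K = {}"
  then obtain a b where "a \<noteq> 0" and K: "K \<subseteq> {x. a \<bullet> x = b}"
    using empty_interior_subset_hyperplane[OF \<open>convex K\<close>] by blast
  have corner: "a \<bullet> p = 0" if "p \<in> corners \<sigma> B" for p
  proof -
    have "t + p \<in> K" "t + 0 \<in> K"
      using t that by (auto simp: X_set_iff_corners corners_def)
    then have "a \<bullet> (t + p) = b" "a \<bullet> t = b"
      using K by auto
    then show ?thesis by (simp add: inner_add_right)
  qed
  have "B 1 + B 2 + B 3 = B (\<sigma> 1) + B (\<sigma> 2) + B (\<sigma> 3)"
    using sum.permute[OF \<sigma>, of B] by (simp add: sum_3)
  then have "a \<bullet> B (\<sigma> 1) = 0" "a \<bullet> B (\<sigma> 2) = 0" "a \<bullet> B (\<sigma> 3) = 0"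
    using corner[of "B (\<sigma> 1)"] corner[of "B (\<sigma> 1) + B (\<sigma> 2)"] corner[of "B 1 + B 2 + B 3"]
    by (simp_all add: corners_def inner_add_right)
  then have "\<forall>i. a \<bullet> B i = 0"
    unfolding all_3_perm[OF \<sigma>] by blast
  then have "orthogonal a v" if "v \<in> range B" for v
    using that by (auto simp: orthogonal_def)
  then have "orthogonal a a"
    using lattice_basis_coordinates(4)[OF B] by (intro orthogonal_to_span[of a "range B"]) auto
  then show False
    using \<open>a \<noteq> 0\<close> by (simp add: orthogonal_def)
qed

theorem proposition6p1:
  fixes B :: "3 \<Rightarrow> real ^ 3" and \<Lambda> K :: "(real ^ 3) set"
  assumes "lattice_basis B \<Lambda>" and "convex_body K"
  shows
    "(\<forall>\<sigma>. \<sigma> permutes (UNIV :: 3 set) \<longrightarrow>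
        (\<exists>t. (+) t ` Delta \<sigma> B \<subseteq> K) \<longleftrightarrow> X_set \<sigma> K B \<noteq> {}) \<and>
     ((\<forall>\<sigma>. \<sigma> permutes (UNIV :: 3 set) \<longrightarrow> X_set \<sigma> K B \<noteq> {}) \<longrightarrow> K + \<Lambda> = UNIV) \<and>
     ((\<forall>\<sigma>. \<sigma> permutes (UNIV :: 3 set) \<longrightarrow> X_set \<sigma> K B \<noteq> {}) \<and> minimal_covering_body \<Lambda> K \<longrightarrow>
        (\<forall>t :: (3 \<Rightarrow> 3) \<Rightarrow> real ^ 3.
           (\<forall>\<sigma>. \<sigma> permutes (UNIV :: 3 set) \<longrightarrow> t \<sigma> \<in> X_set \<sigma> K B) \<longrightarrow>
           K = convex hull (\<Union>\<sigma>\<in>{\<sigma>. \<sigma> permutes (UNIV :: 3 set)}. (+) (t \<sigma>) ` Delta \<sigma> B)))"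
proof -
  let ?S = "{\<sigma>. \<sigma> permutes (UNIV :: 3 set)}"
  have "convex K"
    using assms(2) by (simp add: convex_body_def)
  have cover: "C + \<Lambda> = UNIV"
    if "convex C" and "\<And>\<sigma>. \<sigma> permutes UNIV \<Longrightarrow> t \<sigma> \<in> X_set \<sigma> C B" for C and t :: "(3 \<Rightarrow> 3) \<Rightarrow> real ^ 3"
    using that by (intro corner_translates_cover[OF assms(1), of _ t]) (auto simp: X_set_iff_corners)
  have part1: "(\<exists>t. (+) t ` Delta \<sigma> B \<subseteq> K) \<longleftrightarrow> X_set \<sigma> K B \<noteq> {}" for \<sigma>
    using Delta_translate_subset_iff[OF \<open>convex K\<close>] by auto
  have part2: "K + \<Lambda> = UNIV" if "\<forall>\<sigma>. \<sigma> permutes (UNIV :: 3 set) \<longrightarrow> X_set \<sigma> K B \<noteq> {}"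
    using that by (intro cover[OF \<open>convex K\<close>, of "\<lambda>\<sigma>. SOME t. t \<in> X_set \<sigma> K B"]) (simp add: some_in_eq)
  have part3: "K = convex hull (\<Union>\<sigma>\<in>?S. (+) (t \<sigma>) ` Delta \<sigma> B)" (is "K = ?H")
    if min: "minimal_covering_body \<Lambda> K"
      and t: "\<And>\<sigma>. \<sigma> permutes (UNIV :: 3 set) \<Longrightarrow> t \<sigma> \<in> X_set \<sigma> K B" for t
  proof -
    have tH: "t \<sigma> \<in> X_set \<sigma> ?H B" if "\<sigma> permutes UNIV" for \<sigma>
    proof -
      have "(+) (t \<sigma>) ` Delta \<sigma> B \<subseteq> (\<Union>\<sigma>\<in>?S. (+) (t \<sigma>) ` Delta \<sigma> B)"
        using that by blast
      also have "\<dots> \<subseteq> ?H"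
        by (rule hull_subset)
      finally show ?thesis
        by (simp add: Delta_translate_subset_iff)
    qed
    have "compact (Delta \<sigma> B)" for \<sigma>
      unfolding Delta_def by (intro finite_imp_compact_convex_hull) auto
    then have "compact ?H"
      by (intro compact_convex_hull compact_UN compact_translation) (auto simp: finite_permutations)
    moreover have "interior ?H \<noteq> {}"
      using convex_interior_nonempty_of_corners[OF assms(1) convex_convex_hull permutes_id tH[OF permutes_id]] .
    ultimately have "convex_body ?H"
      by (simp add: convex_body_def)
    moreover have "?H \<subseteq> K"
      using t Delta_translate_subset_iff[OF \<open>convex K\<close>] by (intro hull_minimal \<open>convex K\<close>) blast
    moreover have "?H + \<Lambda> = UNIV"
      by (rule cover[OF convex_convex_hull tH])
    ultimately show ?thesis
      using min unfolding minimal_covering_body_def by blast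
  qed
  show ?thesis
    using part1 part2 part3 by blast
qed

end
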